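(* Let $\rho_0\in L^\infty(\mathbb{R};[0,1])$ and let the following CFL condition hold: $$\Delta t\le\min\left\{\frac{\Delta x}{\gamma_0\|v'\|_{L^\infty([0,1])}+\|v\|_{L^\infty([0,1])}},\ \frac{L}{\|q_{\mathrm{on}}\|_{L^\infty([0,T])}+\|q_{\mathrm{off}}\|_{L^\infty([0,T])}}\right\}.$$ Then the piecewise constant approximate solution $\rho_\Delta$ constructed by the scheme in the context (Model 1) satisfies $0\le\rho_\Delta(t,x)\le1$ for all $t\in[0,T]$ and $x\in\mathbb{R}$.
   Context: Assumptions. $T>0$; $q_{\mathrm{on}},q_{\mathrm{off}}\in L^\infty(\mathbb{R}^+;\mathbb{R}^+)$; $v\in C^2(\mathbb{R};[0,1])$, $v'\le 0$; $\eta\in(0,1]$, $\delta\in[-\eta,\eta]$; $\omega_\eta\in C^1([0,\eta];\mathbb{R}^+)$, $\omega_\eta'\le 0$, $\int_0^\eta\omega_\eta=1$; $\omega_{\eta,\delta}\in C^1([\delta-\eta,\delta+\eta];\mathbb{R}^+)$, $\omega_{\eta,\delta}'\ge0$ on $[\delta-\eta,0]$, $\omega_{\eta,\delta}'\le0$ on $[0,\delta+\eta]$, $\int_{\delta-\eta}^{\delta+\eta}\omega_{\eta,\delta}=1$ ($\omega_{\eta,\delta}$ is extended by $0$ outside its interval). Mesh. $\Delta x>0$ with $\eta=N\Delta x$, $N\in\mathbb{N}$; $\Delta t>0$, $\lambda=\Delta t/\Delta x$; $x_{j-1/2}=j\Delta x$, $x_j=(j+\tfrac12)\Delta x$ for $j\in\mathbb{Z}$;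 $t^n=n\Delta t$; $N_T\in\mathbb{N}$ with $N_T\Delta t\le T<(N_T+1)\Delta t$. The ramps are $\Omega_{\mathrm{on}}=[\underline{x}_{\mathrm{on}},\overline{x}_{\mathrm{on}}]=[x_{\underline{k}_{\mathrm{on}}+1/2},x_{\underline{k}_{\mathrm{on}}+1/2+\ell}]$, $\Omega_{\mathrm{off}}=[\underline{x}_{\mathrm{off}},\overline{x}_{\mathrm{off}}]=[x_{\underline{k}_{\mathrm{off}}+1/2},x_{\underline{k}_{\mathrm{off}}+1/2+\ell}]$ with $\underline{k}_{\mathrm{on}},\underline{k}_{\mathrm{off}}\in\mathbb{Z}$, $\ell\in\mathbb{Z}^+$, length $L=\ell\Delta x$. $\mathbf{1}_{\mathrm{on},j}=1/L$ if $x_j\in\Omega_{\mathrm{on}}$ and $0$ otherwise; $\mathbf{1}_{\mathrm{off},j}=1/L$ if $x_j\in\Omega_{\mathrm{off}}$ and $0$ otherwise. Discrete data. $\rho_j^0=\frac1{\Delta x}\int_{x_{j-1/2}}^{x_{j+1/2}}\rho_0\,dx$; $q_{\mathrm{on}}^{n+1/2}=\frac1{\Delta t}\int_{t^n}^{t^{n+1}}q_{\mathrm{on}}\,dt$, $q_{\mathrm{off}}^{n+1/2}=\frac1{\Delta t}\int_{t^n}^{t^{n+1}}q_{\mathrm{off}}\,dt$; $\gamma_p=\int_{p\Delta x}^{(p+1)\Delta x}\omega_\eta(y)\,dy$ for $0\le p\le N-1$; $\hat\gamma_h=\int_{h\Delta x}^{(h+1)\Delta x}\omega_{\eta,\delta}(y)\,dy$.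 Scheme, for $n=0,\dots,N_T-1$, $j\in\mathbb{Z}$: $R_{j+1/2}^n=\sum_{p=0}^{N-1}\gamma_p\rho_{j+p+1}^n$, $\rho_j^{n+1/2}=\rho_j^n-\lambda\big(\rho_j^nv(R_{j+1/2}^n)-\rho_{j-1}^nv(R_{j-1/2}^n)\big)$, $R_{\mathrm{on},j}^{n+1/2}=\sum_{h=\lfloor(\delta-\eta)/\Delta x\rfloor}^{\lfloor(\delta+\eta)/\Delta x\rfloor-1}\hat\gamma_h\rho_{j+h}^{n+1/2}$, $\rho_j^{n+1}=\rho_j^{n+1/2}+\Delta t\,S_{\mathrm{on},j}^{n+1/2}-\Delta t\,S_{\mathrm{off},j}^{n+1/2}$, with $S_{\mathrm{off},j}^{n+1/2}=\mathbf{1}_{\mathrm{off},j}q_{\mathrm{off}}^{n+1/2}\rho_j^{n+1/2}$ and (Model 1) $S_{\mathrm{on},j}^{n+1/2}=\mathbf{1}_{\mathrm{on},j}q_{\mathrm{on}}^{n+1/2}(1-\rho_j^{n+1/2})(1-R_{\mathrm{on},j}^{n+1/2})$. Approximate solution: $\rho_\Delta(t,x)=\rho_j^n$ for $t\in[t^n,t^{n+1}[\,\cap[0,T]$, $x\in\,]x_{j-1/2},x_{j+1/2}]$, $n=0,\dots,N_T$, $j\in\mathbb{Z}$. *)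

theory Defs
  imports "HOL-Analysis.Analysis" "HOL-Probability.Essential_Supremum"
begin

section \<open>Function spaces\<close>

text \<open>On a compact interval the derivative is the one relative to the interval
  (one-sided at the end points).\<close>

definition deriv_on :: "real set \<Rightarrow> (real \<Rightarrow> real) \<Rightarrow> real \<Rightarrow> real" where
  "deriv_on S f x = vector_derivative f (at x within S)"

definition C1_on :: "real set \<Rightarrow> (real \<Rightarrow> real) \<Rightarrow> bool" where
  "C1_on S f \<longleftrightarrow> f differentiable_on S \<and> continuous_on S (deriv_on S f)"

definition Linf_norm :: "real set \<Rightarrow> (real \<Rightarrow> real) \<Rightarrow> ereal" where
  "Linf_norm S f = esssup (lebesgue_on S) (\<lambda>x. ereal \<bar>f x\<bar>)"

definition Linf :: "real set \<Rightarrow> (real \<Rightarrow> real) set" where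
  "Linf S = {f. f \<in> borel_measurable (lebesgue_on S) \<and> Linf_norm S f < \<infinity>}"

definition zero_ext :: "real set \<Rightarrow> (real \<Rightarrow> real) \<Rightarrow> real \<Rightarrow> real" where
  "zero_ext S f x = (if x \<in> S then f x else 0)"


section \<open>Mesh, ramps and discrete data\<close>

text \<open>\<open>face dx j\<close> is $x_{j-1/2} = j\,\Delta x$, so that $x_{j+1/2}$ is \<open>face dx (j + 1)\<close>.\<close>

definition face :: "real \<Rightarrow> int \<Rightarrow> real" where
  "face dx j = of_int j * dx"

definition center :: "real \<Rightarrow> int \<Rightarrow> real" where
  "center dx j = (of_int j + 1/2) * dx"

definition time :: "real \<Rightarrow> nat \<Rightarrow> real" where
  "time dt n = real n * dt"

text \<open>The ramp $[x_{k+1/2}, x_{k+1/2+l}]$ and its normalised indicator.\<close>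

definition ramp :: "real \<Rightarrow> int \<Rightarrow> int \<Rightarrow> real set" where
  "ramp dx k l = {face dx (k + 1) .. face dx (k + 1 + l)}"

definition ramp_ind :: "real \<Rightarrow> int \<Rightarrow> int \<Rightarrow> int \<Rightarrow> real" where
  "ramp_ind dx k l j = (if center dx j \<in> ramp dx k l then 1 / (of_int l * dx) else 0)"

definition cell_avg :: "real \<Rightarrow> (real \<Rightarrow> real) \<Rightarrow> int \<Rightarrow> real" where
  "cell_avg dx f j = 1 / dx * (LINT x:{face dx j .. face dx (j + 1)}|lebesgue. f x)"

definition time_avg :: "real \<Rightarrow> (real \<Rightarrow> real) \<Rightarrow> nat \<Rightarrow> real" where
  "time_avg dt q n = 1 / dt * (LINT t:{time dt n .. time dt (n + 1)}|lebesgue. q t)"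

text \<open>Kernel weights: $\gamma_p$ for the kernel \<open>w\<close> $= \omega_\eta$, and $\hat\gamma_h$ for
  the kernel \<open>w\<close> $= \omega_{\eta,\delta}$ extended by zero.\<close>

definition weight :: "real \<Rightarrow> (real \<Rightarrow> real) \<Rightarrow> int \<Rightarrow> real" where
  "weight dx w h = (LINT y:{of_int h * dx .. (of_int h + 1) * dx}|lebesgue. w y)"


section \<open>The scheme for Model 1\<close>

text \<open>\<open>R_down dx N w r j\<close> is the downstream average $R_{j+1/2}$ of the grid function \<open>r\<close>.\<close>

definition R_down :: "real \<Rightarrow> nat \<Rightarrow> (real \<Rightarrow> real) \<Rightarrow> (int \<Rightarrow> real) \<Rightarrow> int \<Rightarrow> real" where
  "R_down dx N w r j = (\<Sum>p<N. weight dx w (int p) * r (j + int p + 1))"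

definition half_step ::
  "real \<Rightarrow> real \<Rightarrow> nat \<Rightarrow> (real \<Rightarrow> real) \<Rightarrow> (real \<Rightarrow> real) \<Rightarrow> (int \<Rightarrow> real) \<Rightarrow> int \<Rightarrow> real" where
  "half_step dx dt N v w r j =
     r j - dt / dx * (r j * v (R_down dx N w r j) - r (j - 1) * v (R_down dx N w r (j - 1)))"

definition R_on ::
  "real \<Rightarrow> real \<Rightarrow> real \<Rightarrow> (real \<Rightarrow> real) \<Rightarrow> (int \<Rightarrow> real) \<Rightarrow> int \<Rightarrow> real" where
  "R_on dx \<eta> \<delta> wd r j =
     (\<Sum>h = \<lfloor>(\<delta> - \<eta>) / dx\<rfloor> .. \<lfloor>(\<delta> + \<eta>) / dx\<rfloor> - 1.
        weight dx (zero_ext {\<delta> - \<eta> .. \<delta> + \<eta>} wd) h * r (j + h))"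

definition S_on ::
  "real \<Rightarrow> real \<Rightarrow> real \<Rightarrow> (real \<Rightarrow> real) \<Rightarrow> int \<Rightarrow> int \<Rightarrow> real \<Rightarrow> (int \<Rightarrow> real) \<Rightarrow> int \<Rightarrow> real" where
  "S_on dx \<eta> \<delta> wd k l q r j = ramp_ind dx k l j * q * (1 - r j) * (1 - R_on dx \<eta> \<delta> wd r j)"

definition S_off ::
  "real \<Rightarrow> int \<Rightarrow> int \<Rightarrow> real \<Rightarrow> (int \<Rightarrow> real) \<Rightarrow> int \<Rightarrow> real" where
  "S_off dx k l q r j = ramp_ind dx k l j * q * r j"

text \<open>\<open>rho \<dots> n j\<close> is $\rho_j^n$. The recursion is total in \<open>n\<close>; only the
  values with $n \le N_T$ enter the approximate solution below.\<close>

primrec rho ::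
  "real \<Rightarrow> real \<Rightarrow> nat \<Rightarrow> (real \<Rightarrow> real) \<Rightarrow> (real \<Rightarrow> real) \<Rightarrow> real \<Rightarrow> real \<Rightarrow> (real \<Rightarrow> real) \<Rightarrow>
   int \<Rightarrow> int \<Rightarrow> int \<Rightarrow> (real \<Rightarrow> real) \<Rightarrow> (real \<Rightarrow> real) \<Rightarrow> (real \<Rightarrow> real) \<Rightarrow> nat \<Rightarrow> int \<Rightarrow> real" where
  "rho dx dt N v w \<eta> \<delta> wd k_on k_off l q_on q_off \<rho>0 0 = cell_avg dx \<rho>0"
| "rho dx dt N v w \<eta> \<delta> wd k_on k_off l q_on q_off \<rho>0 (Suc n) =
     (let r = half_step dx dt N v w (rho dx dt N v w \<eta> \<delta> wd k_on k_off l q_on q_off \<rho>0 n)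
      in (\<lambda>j. r j + dt * S_on dx \<eta> \<delta> wd k_on l (time_avg dt q_on n) r j
               - dt * S_off dx k_off l (time_avg dt q_off n) r j))"

text \<open>The piecewise constant function on $[0,T] \times \mathbb{R}$ taking the value \<open>r n j\<close> on
  $([t^n,t^{n+1}[ \,\cap\, [0,T]) \times ]x_{j-1/2},x_{j+1/2}]$, for $0 \le n \le N_T$.\<close>

definition pw_const ::
  "real \<Rightarrow> real \<Rightarrow> real \<Rightarrow> nat \<Rightarrow> (nat \<Rightarrow> int \<Rightarrow> real) \<Rightarrow> real \<Rightarrow> real \<Rightarrow> real" where
  "pw_const dx dt T NT r t x =
     r (THE n. n \<le> NT \<and> t \<in> {time dt n ..< time dt (n + 1)} \<inter> {0 .. T})
       (THE j. x \<in> {face dx j <.. face dx (j + 1)})"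

lemma pw_const_eq:
  assumes "dx > 0" "dt > 0" "n \<le> NT"
    and t: "t \<in> {time dt n ..< time dt (n + 1)} \<inter> {0 .. T}"
    and x: "x \<in> {face dx j <.. face dx (j + 1)}"
  shows "pw_const dx dt T NT r t x = r n j"
proof -
  have time_uniq: "m = n" if "t \<in> {time dt m ..< time dt (m + 1)}" for m
  proof -
    have "time dt m < time dt (n + 1)" "time dt n < time dt (m + 1)"
      using that t unfolding Int_iff atLeastLessThan_iff by linarith+
    then have "real m < real (n + 1)" "real n < real (m + 1)"
      unfolding time_def mult_less_cancel_right_pos[OF \<open>dt > 0\<close>] .
    then show ?thesis by linarith
  qed
  have 1: "(THE n. n \<le> NT \<and> t \<in> {time dt n ..< time dt (n + 1)} \<inter> {0 .. T}) = n"
  proof (rule the_equality)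
    show "n \<le> NT \<and> t \<in> {time dt n ..< time dt (n + 1)} \<inter> {0 .. T}"
      using \<open>n \<le> NT\<close> t by (rule conjI)
    show "m = n" if "m \<le> NT \<and> t \<in> {time dt m ..< time dt (m + 1)} \<inter> {0 .. T}" for m
      using time_uniq that by blast
  qed
  have face_uniq: "i = j" if "x \<in> {face dx i <.. face dx (i + 1)}" for i
  proof -
    have "face dx i < face dx (j + 1)" "face dx j < face dx (i + 1)"
      using that x unfolding greaterThanAtMost_iff by linarith+
    then have "(of_int i :: real) < of_int (j + 1)" "(of_int j :: real) < of_int (i + 1)"
      unfolding face_def mult_less_cancel_right_pos[OF \<open>dx > 0\<close>] .
    then show ?thesis by linarith
  qed
  have 2: "(THE j. x \<in> {face dx j <.. face dx (j + 1)}) = j"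
    using x face_uniq by (rule the_equality)
  show ?thesis unfolding pw_const_def 1 2 ..
qed

text \<open>The CFL bounds are quotients of extended reals, since the norms are; a vanishing
  denominator thus imposes no restriction on the time step.\<close>

lemma ereal_pos_div_zero: "c > 0 \<Longrightarrow> ereal c / 0 = \<infinity>"
  by (simp add: divide_ereal_def)

end

theory Submission
  imports Defs
begin

text \<open>Each time step maps grid functions with values in $[0,1]$ to grid functions with values in
  $[0,1]$, and the initial cell averages have values in $[0,1]$.

  In the convective half step the new density is nonnegative, because a cell loses at most the
  fraction \<open>\<lambda> \<parallel>v\<parallel> \<le> 1\<close> of its content. It does not exceed one, because the net inflow is at most
  a multiple of the free capacity \<open>1 - \<rho>\<^sub>j\<close> (\<open>half_step_in_unit_interval\<close>): the nonnegative weights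
  \<open>\<gamma>\<^sub>p\<close> decrease in \<open>p\<close>, so summation by parts shows that the downstream average grows by at
  most \<open>\<gamma>\<^sub>0 (1 - \<rho>\<^sub>j)\<close> across cell \<open>j\<close> (\<open>R_down_diff_le\<close>), and the velocity drops by at most
  \<open>\<parallel>v'\<parallel>\<close> times that. The first bound of the CFL condition makes the multiple at most one.

  In the source step the second bound of the CFL condition makes the fraction of the free capacity
  that can be filled and the fraction of the content that leaves at most one each, so neither the
  inflow nor the outflow overshoots (\<open>source_update_in_unit_interval\<close>). The inflow is
  nonnegative and no larger than this fraction, because the weights \<open>\<gamma>\<close>-hat are nonnegative with
  sum at most one, so that the average with the on-ramp kernel again lies in $[0,1]$
  (\<open>sum_weight_zero_ext_le\<close>).

  The norms in the CFL condition are essential suprema. For \<open>v\<close> and its derivative these bound the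
  function at every point, by continuity (\<open>continuous_on_Icc_AE_bound\<close>); the ramp fluxes enter only
  through time averages over subintervals of $[0,T]$, for which almost everywhere bounds suffice.\<close>

section \<open>Integrals over intervals and essential bounds\<close>

lemma set_integral_Icc_bounds:
  fixes f :: "real \<Rightarrow> real"
  assumes "a \<le> b" "0 \<le> C" "AE x in lebesgue. x \<in> {a..b} \<longrightarrow> 0 \<le> f x \<and> f x \<le> C"
  shows "0 \<le> (LINT x:{a..b}|lebesgue. f x)" "(LINT x:{a..b}|lebesgue. f x) \<le> (b - a) * C"
proof -
  show "0 \<le> (LINT x:{a..b}|lebesgue. f x)"
    unfolding set_lebesgue_integral_def
    by (rule integral_nonneg_AE) (use assms in \<open>auto simp: indicator_def\<close>)
  \<comment> \<open>if \<open>f\<close> is not integrable, its integral is zero, which obeys the bound as well\<close>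
  have const: "set_integrable lebesgue {a..b} (\<lambda>_. C)"
    by (intro absolutely_integrable_continuous_real continuous_on_const)
  have "(LINT x:{a..b}|lebesgue. f x) \<le> (LINT x:{a..b}|lebesgue. C)"
    unfolding set_lebesgue_integral_def
    by (rule integral_mono_AE'[OF const[unfolded set_integrable_def]])
      (use assms in \<open>auto simp: indicator_def\<close>)
  also have "\<dots> = (b - a) * C"
    using assms by (simp add: set_lebesgue_integral_def)
  finally show "(LINT x:{a..b}|lebesgue. f x) \<le> (b - a) * C" .
qed

lemma Linf_Icc_bound:
  assumes "a < b" "f \<in> Linf {a..b}"
  obtains M where "0 \<le> M" "Linf_norm {a..b} f = ereal M"
    "AE x in lebesgue. x \<in> {a..b} \<longrightarrow> \<bar>f x\<bar> \<le> M"
proof -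
  let ?L = "lebesgue_on {a..b}"
  have "emeasure ?L (space ?L) \<noteq> 0"
    using assms(1) by (simp add: emeasure_restrict_space)
  then have "0 = esssup ?L (\<lambda>x. 0 :: ereal)"
    by (simp add: esssup_const)
  also have "\<dots> \<le> Linf_norm {a..b} f"
    unfolding Linf_norm_def by (rule esssup_mono) auto
  finally have "0 \<le> Linf_norm {a..b} f" .
  moreover have "Linf_norm {a..b} f < \<infinity>"
    using assms(2) by (simp add: Linf_def)
  ultimately obtain M where M: "0 \<le> M" "Linf_norm {a..b} f = ereal M"
    by (cases "Linf_norm {a..b} f") auto
  have "AE x in ?L. ereal \<bar>f x\<bar> \<le> ereal M"
    using esssup_AE[of "\<lambda>x. ereal \<bar>f x\<bar>" ?L] M(2) by (simp add: Linf_norm_def)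
  then have "AE x in lebesgue. x \<in> {a..b} \<longrightarrow> \<bar>f x\<bar> \<le> M"
    by (subst (asm) AE_restrict_space_iff) auto
  with M that show thesis by blast
qed

lemma Linf_mono:
  assumes "f \<in> Linf S" "A \<subseteq> S" "A \<in> sets lebesgue" "S \<in> sets lebesgue"
  shows "f \<in> Linf A"
proof -
  have meas: "f \<in> borel_measurable (lebesgue_on A)"
    using assms by (auto simp: Linf_def intro: measurable_restrict_mono)
  have "AE x in lebesgue_on S. ereal \<bar>f x\<bar> \<le> Linf_norm S f"
    unfolding Linf_norm_def by (rule esssup_AE)
  then have "AE x in lebesgue_on A. ereal \<bar>f x\<bar> \<le> Linf_norm S f"
    using assms by (auto simp: AE_restrict_space_iff)
  then have "Linf_norm A f \<le> Linf_norm S f"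
    unfolding Linf_norm_def[of A] using meas by (intro esssup_I) auto
  with meas assms(1) show ?thesis
    by (auto simp: Linf_def)
qed

lemma continuous_on_Icc_Linf:
  assumes "continuous_on {a..b} f"
  shows "f \<in> Linf {a..b}"
proof -
  have meas: "f \<in> borel_measurable (lebesgue_on {a..b})"
    using assms by (intro continuous_imp_measurable_on_sets_lebesgue) auto
  have "bounded (f ` {a..b})"
    using assms by (intro compact_imp_bounded compact_continuous_image) auto
  then obtain B where "\<forall>x\<in>{a..b}. \<bar>f x\<bar> \<le> B"
    unfolding bounded_iff by auto
  then have "Linf_norm {a..b} f \<le> ereal B"
    unfolding Linf_norm_def using meas by (intro esssup_I AE_I2) auto
  with meas show ?thesis by (auto simp: Linf_def)
qed

text \<open>For a continuous function the exceptional set is relatively open, and a nonempty relatively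
  open subset of a nondegenerate interval has positive measure.\<close>

lemma continuous_on_Icc_AE_bound:
  fixes f :: "real \<Rightarrow> real"
  assumes "a < b" "continuous_on {a..b} f" "AE x in lebesgue. x \<in> {a..b} \<longrightarrow> \<bar>f x\<bar> \<le> M"
    and "x \<in> {a..b}"
  shows "\<bar>f x\<bar> \<le> M"
proof -
  let ?C = "{x \<in> {a..b}. \<bar>f x\<bar> \<le> M}"
  have "closed ?C"
    using assms(2) by (intro continuous_closed_preimage_constant continuous_on_closed_Collect_le
      continuous_intros) auto
  moreover have "{a<..<b} \<subseteq> ?C"
  proof
    fix y assume "y \<in> {a<..<b}"
    then show "y \<in> ?C"
      by (rule mem_closed_if_AE_lebesgue_open[OF open_greaterThanLessThan \<open>closed ?C\<close>, rotated])
        (use assms(3) in auto)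
  qed
  ultimately have "closure {a<..<b} \<subseteq> ?C"
    by (rule closure_minimal[rotated])
  then show ?thesis
    using assms(1,4) by auto
qed


section \<open>Kernel weights\<close>

lemma C1_on_continuous_on: "C1_on S f \<Longrightarrow> continuous_on S f"
  by (simp add: C1_on_def differentiable_imp_continuous_on)

lemma C1_on_Icc_antimono:
  assumes "C1_on {a..b} f" "\<And>y. y \<in> {a..b} \<Longrightarrow> deriv_on {a..b} f y \<le> 0"
    and "a \<le> x" "x \<le> y" "y \<le> b"
  shows "f y \<le> f x"
proof (rule DERIV_nonpos_imp_decreasing_open[of x y f])
  show "x \<le> y" using assms(4) .
  show "continuous_on {x..y} f"
    using C1_on_continuous_on[OF assms(1)] assms by (elim continuous_on_subset) auto
next
  fix z assume z: "x < z" "z < y"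
  have "f differentiable (at z within {a..b})"
    using assms z by (simp add: C1_on_def differentiable_on_def)
  then have "(f has_vector_derivative deriv_on {a..b} f z) (at z within {a..b})"
    unfolding deriv_on_def by (simp add: vector_derivative_works)
  moreover have "at z within {a..b} = at z"
    using assms z by (intro at_within_Icc_at) auto
  ultimately have "DERIV f z :> deriv_on {a..b} f z"
    by (simp add: has_real_derivative_iff_has_vector_derivative)
  then show "\<exists>d. DERIV f z :> d \<and> d \<le> 0"
    using assms z by (intro exI[of _ "deriv_on {a..b} f z"]) auto
qed

lemma weight_nonneg:
  assumes "\<And>y. y \<in> {of_int h * dx .. (of_int h + 1) * dx} \<Longrightarrow> 0 \<le> w y"
  shows "0 \<le> weight dx w h"
  unfolding weight_def set_lebesgue_integral_def
  using assms by (intro integral_nonneg_AE AE_I2) (auto simp: indicator_def)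

text \<open>Both weights are compared with the value of the kernel at the face that the two cells
  share.\<close>

lemma weight_Suc_le:
  assumes "0 < dx" "continuous_on {of_int h * dx .. (of_int h + 2) * dx} w"
    and anti: "\<And>x y. of_int h * dx \<le> x \<Longrightarrow> x \<le> y \<Longrightarrow> y \<le> (of_int h + 2) * dx \<Longrightarrow> w y \<le> w x"
  shows "weight dx w (h + 1) \<le> weight dx w h"
proof -
  let ?m = "(of_int h + 1) * dx"
  have faces: "of_int h * dx \<le> ?m" "?m \<le> (of_int h + 2) * dx"
    using assms(1) by (auto simp: algebra_simps)
  have int: "set_integrable lebesgue {a..b} w"
    if "of_int h * dx \<le> a" "b \<le> (of_int h + 2) * dx" for a b
    using that assms(2)
    by (intro absolutely_integrable_continuous_real) (auto elim: continuous_on_subset)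
  have const: "set_integrable lebesgue {a..b} (\<lambda>_. c)" for a b c :: real
    by (intro absolutely_integrable_continuous_real) auto
  have val: "(LINT y:{a..b}|lebesgue. c) = (b - a) * c" if "a \<le> b" for a b c :: real
    using that by (simp add: set_lebesgue_integral_def)
  have "weight dx w (h + 1) = (LINT y:{?m .. (of_int h + 2) * dx}|lebesgue. w y)"
    by (simp add: weight_def add.assoc)
  also have "\<dots> \<le> (LINT y:{?m .. (of_int h + 2) * dx}|lebesgue. w ?m)"
    using faces by (intro set_integral_mono int const anti) auto
  also have "\<dots> = (LINT y:{of_int h * dx .. ?m}|lebesgue. w ?m)"
    using faces by (simp add: val algebra_simps)
  also have "\<dots> \<le> weight dx w h"
    unfolding weight_def using faces by (intro set_integral_mono int const anti) auto
  finally show ?thesis .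
qed

text \<open>The cells overlap only in faces, a countable set, so the weights over finitely many cells add
  up to the integral of the kernel over their union.\<close>

lemma sum_weight_le_integral:
  assumes "0 < dx" "finite H" "integrable lebesgue w" "\<And>y. 0 \<le> w y"
  shows "(\<Sum>h\<in>H. weight dx w h) \<le> integral\<^sup>L lebesgue w"
proof -
  let ?c = "\<lambda>h::int. {of_int h * dx .. (of_int h + 1) * dx}"
  let ?F = "range (\<lambda>h::int. of_int h * dx)"
  have "?F \<in> null_sets lebesgue"
    using countable_imp_null_set_lborel[of ?F] by (simp add: null_sets_completionI)
  then have noface: "AE y in lebesgue. y \<notin> ?F"
    by (rule AE_not_in)
  have cell: "i = j" if "y \<in> ?c i" "y \<in> ?c j" "y \<notin> ?F" for i j y
  proof -
    have "y \<noteq> of_int k * dx" for k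
      using that(3) by blast
    from this[of i] this[of j] have "of_int i * dx < y" "of_int j * dx < y"
      using that by force+
    with that have "of_int i * dx < (of_int j + 1) * dx" "of_int j * dx < (of_int i + 1) * dx"
      by auto
    then have "(of_int i :: real) < of_int j + 1" "(of_int j :: real) < of_int i + 1"
      unfolding mult_less_cancel_right_pos[OF assms(1)] .
    then show ?thesis by linarith
  qed
  have int: "set_integrable lebesgue A w" if "A \<in> sets lebesgue" for A
    using assms(3) that by (simp add: set_integrable_def integrable_mult_indicator del: real_scaleR_def)
  have "(\<Sum>h\<in>H. weight dx w h) = (LINT y:(\<Union>h\<in>H. ?c h)|lebesgue. w y)"
    unfolding weight_def
  proof (rule set_integral_finite_UN_AE[symmetric])
    fix i j show "AE y in lebesgue. y \<in> ?c i \<and> y \<in> ?c j \<longrightarrow> i = j"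
      using noface by eventually_elim (use cell in blast)
  qed (use assms(2) int in auto)
  also have "\<dots> \<le> integral\<^sup>L lebesgue w"
    unfolding set_lebesgue_integral_def
    by (rule integral_mono_AE'[OF assms(3)]) (use assms(4) in \<open>auto simp: indicator_def\<close>)
  finally show ?thesis .
qed

text \<open>The extension by zero covers cells that stick out of \<open>{a..b}\<close>, as the first cell of the
  on-ramp kernel does when the shift is not a multiple of the mesh size.\<close>

lemma sum_weight_zero_ext_le:
  assumes "0 < dx" "finite H" "continuous_on {a..b} w" "\<And>y. y \<in> {a..b} \<Longrightarrow> 0 \<le> w y"
  shows "(\<Sum>h\<in>H. weight dx (zero_ext {a..b} w) h) \<le> (LINT y:{a..b}|lebesgue. w y)"
proof -
  have ext: "zero_ext {a..b} w = (\<lambda>y. indicator {a..b} y *\<^sub>R w y)"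
    by (auto simp: zero_ext_def indicator_def)
  have "integrable lebesgue (zero_ext {a..b} w)"
    using absolutely_integrable_continuous_real[OF assms(3)] by (simp add: ext set_integrable_def)
  from sum_weight_le_integral[OF assms(1,2) this] assms(4) show ?thesis
    by (simp add: ext set_lebesgue_integral_def zero_ext_def indicator_def)
qed

lemma weight_zero_ext:
  assumes "{of_int h * dx .. (of_int h + 1) * dx} \<subseteq> S"
  shows "weight dx (zero_ext S w) h = weight dx w h"
  unfolding weight_def using assms by (intro set_lebesgue_integral_cong) (auto simp: zero_ext_def)

lemma sum_weighted_in_unit_interval:
  fixes g s :: "'a \<Rightarrow> real"
  assumes "\<And>i. i \<in> A \<Longrightarrow> 0 \<le> g i" "\<And>i. i \<in> A \<Longrightarrow> s i \<in> {0..1}" "sum g A \<le> 1"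
  shows "(\<Sum>i\<in>A. g i * s i) \<in> {0..1}"
proof -
  have "(\<Sum>i\<in>A. g i * s i) \<le> sum g A"
    using assms by (intro sum_mono mult_left_le) auto
  moreover have "0 \<le> (\<Sum>i\<in>A. g i * s i)"
    using assms by (intro sum_nonneg) auto
  ultimately show ?thesis using assms(3) by auto
qed


section \<open>The convective half step\<close>

text \<open>Summation by parts moves the differences from \<open>s\<close> to \<open>g\<close>, where they have a sign; the extra
  boundary term \<open>g n * (1 - s (Suc n))\<close> is what the induction needs.\<close>

lemma sum_antimono_weights_diff_le:
  fixes g s :: "nat \<Rightarrow> real"
  assumes "\<And>p. p < n \<Longrightarrow> g (Suc p) \<le> g p" "\<And>p. p \<le> Suc n \<Longrightarrow> s p \<le> 1"
  shows "(\<Sum>p<Suc n. g p * (s (Suc p) - s p)) \<le> g 0 * (1 - s 0) - g n * (1 - s (Suc n))"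
  using assms
proof (induction n)
  case (Suc n)
  have "g (Suc n) * (1 - s (Suc n)) \<le> g n * (1 - s (Suc n))"
    using Suc.prems by (intro mult_right_mono) auto
  moreover have "(\<Sum>p<Suc n. g p * (s (Suc p) - s p)) \<le> g 0 * (1 - s 0) - g n * (1 - s (Suc n))"
    using Suc.prems by (intro Suc.IH) auto
  ultimately show ?case by (simp add: algebra_simps)
qed (simp add: algebra_simps)

lemma R_down_diff_le:
  assumes "0 < N" "\<And>p. p < N \<Longrightarrow> 0 \<le> weight dx w (int p)"
    and "\<And>p. Suc p < N \<Longrightarrow> weight dx w (int (Suc p)) \<le> weight dx w (int p)"
    and "\<And>i. r i \<le> 1"
  shows "R_down dx N w r j - R_down dx N w r (j - 1) \<le> weight dx w 0 * (1 - r j)"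
proof -
  obtain n where N: "N = Suc n"
    using assms(1) gr0_implies_Suc by blast
  let ?g = "\<lambda>p. weight dx w (int p)" and ?s = "\<lambda>p. r (j + int p)"
  have "R_down dx N w r j - R_down dx N w r (j - 1) = (\<Sum>p<Suc n. ?g p * (?s (Suc p) - ?s p))"
    unfolding R_down_def N sum_subtractf[symmetric]
    by (intro sum.cong) (auto simp: algebra_simps)
  also have "\<dots> \<le> ?g 0 * (1 - ?s 0) - ?g n * (1 - ?s (Suc n))"
    using assms N by (intro sum_antimono_weights_diff_le) auto
  also have "\<dots> \<le> weight dx w 0 * (1 - r j)"
    using assms(2)[of n] assms(4) N by simp
  finally show ?thesis .
qed

text \<open>For the upper bound, the inflow is largest when the upstream cell is full, which leaves a net
  inflow proportional to \<open>v R\<^sub>- - r j * v R\<^sub>+ = (v R\<^sub>- - v R\<^sub>+) + (1 - r j) * v R\<^sub>+\<close>, where \<open>R\<^sub>-\<close> and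
  \<open>R\<^sub>+\<close> are the downstream averages at the left and the right face of cell \<open>j\<close>. The first term is
  at most \<open>D\<close> times the growth of the downstream average, so both terms are bounded by a multiple of
  the free capacity \<open>1 - r j\<close>.\<close>

lemma half_step_in_unit_interval:
  assumes "0 < dx" "0 < dt" "0 < N"
    and g: "\<And>p. p < N \<Longrightarrow> 0 \<le> weight dx w (int p)"
      "\<And>p. Suc p < N \<Longrightarrow> weight dx w (int (Suc p)) \<le> weight dx w (int p)"
      "(\<Sum>p<N. weight dx w (int p)) \<le> 1"
    and v: "\<And>x. x \<in> {0..1} \<Longrightarrow> 0 \<le> v x \<and> v x \<le> V"
      "\<And>x y. 0 \<le> x \<Longrightarrow> x \<le> y \<Longrightarrow> y \<le> 1 \<Longrightarrow> v y \<le> v x \<and> v x - v y \<le> D * (y - x)"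
    and "0 \<le> D" and cfl: "dt * (weight dx w 0 * D + V) \<le> dx"
    and r: "\<And>i. r i \<in> {0..1}"
  shows "half_step dx dt N v w r j \<in> {0..1}"
proof -
  define Rp where "Rp = R_down dx N w r j"
  define Rm where "Rm = R_down dx N w r (j - 1)"
  define g0 where "g0 = weight dx w 0"
  define lam where "lam = dt / dx"
  have lam: "0 < lam" "lam * (g0 * D + V) \<le> 1"
    using assms(1,2) cfl by (simp_all add: lam_def g0_def field_simps)
  have g0: "0 \<le> g0"
    using g(1)[of 0] \<open>0 < N\<close> by (simp add: g0_def)
  have R: "Rp \<in> {0..1}" "Rm \<in> {0..1}"
    unfolding Rp_def Rm_def R_down_def using g r
    by (intro sum_weighted_in_unit_interval; auto)+
  have rj: "0 \<le> r j" "r j \<le> 1" and rj1: "0 \<le> r (j - 1)" "r (j - 1) \<le> 1"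
    using r by auto
  have vp: "0 \<le> v Rp" "v Rp \<le> V" and vm: "0 \<le> v Rm"
    using v(1) R by auto
  have drop: "v Rm - v Rp \<le> D * (g0 * (1 - r j))"
  proof (cases "Rm \<le> Rp")
    case True
    have "Rp - Rm \<le> g0 * (1 - r j)"
      unfolding Rp_def Rm_def g0_def using r
      by (intro R_down_diff_le \<open>0 < N\<close> g(1,2)) auto
    then have "D * (Rp - Rm) \<le> D * (g0 * (1 - r j))"
      using \<open>0 \<le> D\<close> by (rule mult_left_mono)
    then show ?thesis
      using v(2)[of Rm Rp] True R by auto
  next
    case False
    then have "v Rm \<le> v Rp"
      using v(2)[of Rp Rm] R by auto
    moreover have "0 \<le> D * (g0 * (1 - r j))"
      using \<open>0 \<le> D\<close> g0 rj by simp
    ultimately show ?thesis by linarith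
  qed
  have step: "half_step dx dt N v w r j = r j - lam * (r j * v Rp - r (j - 1) * v Rm)"
    by (simp add: half_step_def Rp_def Rm_def lam_def)
  have "lam * v Rp \<le> 1"
  proof -
    have "lam * v Rp \<le> lam * (g0 * D + V)"
      using lam(1) vp g0 \<open>0 \<le> D\<close> by (intro mult_left_mono) (auto simp: add_increasing)
    with lam(2) show ?thesis by linarith
  qed
  then have "r j * (lam * v Rp) \<le> r j"
    using rj(1) by (rule mult_left_le)
  moreover have "0 \<le> lam * (r (j - 1) * v Rm)"
    using lam(1) rj1 vm by simp
  ultimately have lower: "0 \<le> half_step dx dt N v w r j"
    by (simp add: step algebra_simps)
  have "r (j - 1) * v Rm - r j * v Rp \<le> v Rm - r j * v Rp"
    using rj1 vm by (simp add: mult_left_le_one_le)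
  also have "\<dots> = (v Rm - v Rp) + (1 - r j) * v Rp"
    by (simp add: algebra_simps)
  also have "\<dots> \<le> D * (g0 * (1 - r j)) + (1 - r j) * V"
    using drop vp rj by (intro add_mono mult_left_mono) auto
  also have "\<dots> = (1 - r j) * (g0 * D + V)"
    by (simp add: algebra_simps)
  finally have "lam * (r (j - 1) * v Rm - r j * v Rp) \<le> lam * ((1 - r j) * (g0 * D + V))"
    using lam(1) by (intro mult_left_mono) auto
  also have "\<dots> = (1 - r j) * (lam * (g0 * D + V))"
    by simp
  also have "\<dots> \<le> 1 - r j"
    using rj lam(2) by (intro mult_left_le) auto
  finally have "half_step dx dt N v w r j \<le> 1"
    by (simp add: step algebra_simps)
  with lower show ?thesis by simp
qed


section \<open>The source step\<close>

text \<open>Entering cars fill at most the fraction \<open>a\<close> of the free capacity, leaving cars are the fraction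
  \<open>b\<close> of those present.\<close>

lemma source_update_in_unit_interval:
  fixes a b r R :: real
  assumes "0 \<le> a" "a \<le> 1" "0 \<le> b" "b \<le> 1" "r \<in> {0..1}" "R \<in> {0..1}"
  shows "r + a * (1 - r) * (1 - R) - b * r \<in> {0..1}"
proof -
  have "b * r \<le> 1 * r"
    using assms by (intro mult_right_mono) auto
  moreover have "0 \<le> a * (1 - r) * (1 - R)"
    using assms by simp
  moreover have "a * (1 - r) * (1 - R) \<le> a * (1 - r)"
    using assms by (intro mult_left_le) auto
  moreover have "a * (1 - r) \<le> 1 * (1 - r)"
    using assms by (intro mult_right_mono) auto
  moreover have "0 \<le> b * r"
    using assms by simp
  ultimately show ?thesis by simp
qed

lemma ramp_ind_bounds:
  assumes "0 < dx" "0 < l"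
  shows "0 \<le> ramp_ind dx k l j" "ramp_ind dx k l j \<le> 1 / (of_int l * dx)"
  using assms by (auto simp: ramp_ind_def)

lemma time_avg_bounds:
  assumes "0 < dt" "0 \<le> M" "time dt (n + 1) \<le> T"
    and "AE t in lebesgue. t \<in> {0..} \<longrightarrow> 0 \<le> q t"
    and "AE t in lebesgue. t \<in> {0..T} \<longrightarrow> \<bar>q t\<bar> \<le> M"
  shows "0 \<le> time_avg dt q n" "time_avg dt q n \<le> M"
proof -
  have t0: "0 \<le> time dt n" and len: "time dt (n + 1) - time dt n = dt"
    using assms(1) by (auto simp: time_def algebra_simps)
  have "AE t in lebesgue. t \<in> {time dt n .. time dt (n + 1)} \<longrightarrow> 0 \<le> q t \<and> q t \<le> M"
    using assms(4,5) by eventually_elim (use t0 assms(3) in auto)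
  from set_integral_Icc_bounds[OF _ assms(2) this] len assms(1)
  show "0 \<le> time_avg dt q n" "time_avg dt q n \<le> M"
    by (auto simp: time_avg_def field_simps)
qed

lemma cell_avg_in_unit_interval:
  assumes "0 < dx" "AE x in lebesgue. f x \<in> {0..1}"
  shows "cell_avg dx f j \<in> {0..1}"
proof -
  have len: "face dx (j + 1) - face dx j = dx"
    by (simp add: face_def algebra_simps)
  have "AE x in lebesgue. x \<in> {face dx j .. face dx (j + 1)} \<longrightarrow> 0 \<le> f x \<and> f x \<le> 1"
    using assms(2) by eventually_elim auto
  from set_integral_Icc_bounds[OF _ _ this] len assms(1) show ?thesis
    by (auto simp: cell_avg_def field_simps)
qed


section \<open>The maximum principle\<close>

lemma pw_const_range:
  assumes "0 < dx" "0 < dt" "T < (real NT + 1) * dt" "t \<in> {0..T}"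
    and "\<And>n j. n \<le> NT \<Longrightarrow> r n j \<in> A"
  shows "pw_const dx dt T NT r t x \<in> A"
proof -
  define n where "n = nat \<lfloor>t / dt\<rfloor>"
  define j where "j = \<lceil>x / dx\<rceil> - 1"
  have "real n = of_int \<lfloor>t / dt\<rfloor>"
    using assms by (simp add: n_def)
  then have "real n \<le> t / dt" "t / dt < real n + 1"
    by linarith+
  then have t: "real n * dt \<le> t" "t < (real n + 1) * dt"
    using assms(2) by (simp_all add: field_simps)
  then have "real n * dt < (real NT + 1) * dt"
    using assms(3,4) by (meson atLeastAtMost_iff le_less_trans less_imp_le order_trans)
  then have "n \<le> NT"
    unfolding mult_less_cancel_right_pos[OF assms(2)] by linarith
  have "of_int j < x / dx" "x / dx \<le> of_int j + 1"
    unfolding j_def by linarith+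
  then have x: "of_int j * dx < x" "x \<le> (of_int j + 1) * dx"
    using assms(1) by (simp_all add: field_simps)
  have "pw_const dx dt T NT r t x = r n j"
    using assms \<open>n \<le> NT\<close> t x by (intro pw_const_eq) (auto simp: time_def face_def add.commute)
  with assms(5) \<open>n \<le> NT\<close> show ?thesis by simp
qed

text \<open>For \<open>n = 0\<close> the quotient is \<open>\<infinity>\<close> and the hypothesis is vacuous, but the conclusion is
  trivial.\<close>

lemma step_restriction_real:
  assumes "ereal d \<le> ereal c / ereal n" "0 \<le> c" "0 \<le> n"
  shows "d * n \<le> c"
proof (cases "n = 0")
  case False
  with assms show ?thesis by (simp add: field_simps)
qed (use assms in simp)

theorem lemma3p1:
  fixes T \<eta> \<delta> dx dt :: real
    and q_on q_off v \<omega> \<omega>\<^sub>d \<rho>0 :: "real \<Rightarrow> real"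
    and N NT :: nat
    and k_on k_off l :: int
  assumes "T > 0"
    and "q_on \<in> Linf {0..}" and "AE t in lebesgue_on {0..}. 0 \<le> q_on t"
    and "q_off \<in> Linf {0..}" and "AE t in lebesgue_on {0..}. 0 \<le> q_off t"
    and "C1_on UNIV v" and "C1_on UNIV (deriv v)"
    and "\<And>x. v x \<in> {0..1}" and "\<And>x. deriv v x \<le> 0"
    and "\<eta> \<in> {0<..1}" and "\<delta> \<in> {-\<eta>..\<eta>}"
    and "C1_on {0..\<eta>} \<omega>"
    and "\<And>y. y \<in> {0..\<eta>} \<Longrightarrow> 0 \<le> \<omega> y"
    and "\<And>y. y \<in> {0..\<eta>} \<Longrightarrow> deriv_on {0..\<eta>} \<omega> y \<le> 0"
    and "(LINT y:{0..\<eta>}|lebesgue. \<omega> y) = 1"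
    and "C1_on {\<delta>-\<eta>..\<delta>+\<eta>} \<omega>\<^sub>d"
    and "\<And>y. y \<in> {\<delta>-\<eta>..\<delta>+\<eta>} \<Longrightarrow> 0 \<le> \<omega>\<^sub>d y"
    and "\<And>y. y \<in> {\<delta>-\<eta>..0} \<Longrightarrow> 0 \<le> deriv_on {\<delta>-\<eta>..\<delta>+\<eta>} \<omega>\<^sub>d y"
    and "\<And>y. y \<in> {0..\<delta>+\<eta>} \<Longrightarrow> deriv_on {\<delta>-\<eta>..\<delta>+\<eta>} \<omega>\<^sub>d y \<le> 0"
    and "(LINT y:{\<delta>-\<eta>..\<delta>+\<eta>}|lebesgue. \<omega>\<^sub>d y) = 1"
    and "dx > 0" and "\<eta> = real N * dx"
    and "dt > 0" and "real NT * dt \<le> T" and "T < (real NT + 1) * dt"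
    and "l > 0"
    and "\<rho>0 \<in> Linf UNIV" and "AE x in lebesgue. \<rho>0 x \<in> {0..1}"
    and "ereal dt \<le> min
           (ereal dx / (ereal (weight dx \<omega> 0) * Linf_norm {0..1} (deriv v) + Linf_norm {0..1} v))
           (ereal (of_int l * dx) / (Linf_norm {0..T} q_on + Linf_norm {0..T} q_off))"
  shows "\<forall>t\<in>{0..T}. \<forall>x.
           0 \<le> pw_const dx dt T NT
                 (rho dx dt N v \<omega> \<eta> \<delta> \<omega>\<^sub>d k_on k_off l q_on q_off \<rho>0) t x \<and>
           pw_const dx dt T NT
                 (rho dx dt N v \<omega> \<eta> \<delta> \<omega>\<^sub>d k_on k_off l q_on q_off \<rho>0) t x \<le> 1"
proof -
  have "0 < N"
    using \<open>\<eta> \<in> {0<..1}\<close> \<open>\<eta> = real N * dx\<close> by (cases N) auto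
  have \<omega>_cont: "continuous_on {0..\<eta>} \<omega>" and \<omega>d_cont: "continuous_on {\<delta>-\<eta>..\<delta>+\<eta>} \<omega>\<^sub>d"
    using assms(12,16) by (simp_all add: C1_on_continuous_on)
  have cell: "{of_int (int p) * dx .. (of_int (int p) + 1) * dx} \<subseteq> {0..\<eta>}" if "p < N" for p
  proof -
    have "(real p + 1) * dx \<le> real N * dx"
      using that \<open>dx > 0\<close> by (intro mult_right_mono) auto
    then show ?thesis
      using \<open>\<eta> = real N * dx\<close> \<open>dx > 0\<close>
      by (intro atLeastatMost_subset_iff[THEN iffD2] disjI2 conjI) auto
  qed
  have \<gamma>_nonneg: "0 \<le> weight dx \<omega> (int p)" if "p < N" for p
    by (rule weight_nonneg) (use cell[OF that] assms(13) in blast)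
  have \<gamma>_anti: "weight dx \<omega> (int (Suc p)) \<le> weight dx \<omega> (int p)" if "Suc p < N" for p
  proof -
    have end_le: "(of_int (int p) + 2) * dx \<le> \<eta>"
      using cell[of "Suc p"] that \<open>dx > 0\<close> by (simp add: algebra_simps)
    have start_ge: "0 \<le> of_int (int p) * dx"
      using \<open>dx > 0\<close> by simp
    have "weight dx \<omega> (int p + 1) \<le> weight dx \<omega> (int p)"
    proof (rule weight_Suc_le[OF \<open>dx > 0\<close>])
      show "continuous_on {of_int (int p) * dx .. (of_int (int p) + 2) * dx} \<omega>"
        using \<omega>_cont end_le start_ge by (elim continuous_on_subset) auto
    next
      fix x y assume "of_int (int p) * dx \<le> x" "x \<le> y" "y \<le> (of_int (int p) + 2) * dx"
      with end_le start_ge show "\<omega> y \<le> \<omega> x"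
        by (intro C1_on_Icc_antimono[OF assms(12,14)]) auto
    qed
    then show ?thesis by (simp add: add.commute)
  qed
  have \<gamma>_sum: "(\<Sum>p<N. weight dx \<omega> (int p)) \<le> 1"
  proof -
    have "(\<Sum>p<N. weight dx \<omega> (int p)) = (\<Sum>p<N. weight dx (zero_ext {0..\<eta>} \<omega>) (int p))"
      by (intro sum.cong refl weight_zero_ext[symmetric] cell) auto
    also have "\<dots> = (\<Sum>h\<in>int ` {..<N}. weight dx (zero_ext {0..\<eta>} \<omega>) h)"
      by (subst sum.reindex) auto
    also have "\<dots> \<le> 1"
      using sum_weight_zero_ext_le[OF \<open>dx > 0\<close> _ \<omega>_cont assms(13), of "int ` {..<N}"] assms(15)
      by simp
    finally show ?thesis .
  qed
  have R_on_range: "R_on dx \<eta> \<delta> \<omega>\<^sub>d r j \<in> {0..1}" if "\<And>i. r i \<in> {0..1}" for r j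
    unfolding R_on_def
  proof (rule sum_weighted_in_unit_interval)
    show "0 \<le> weight dx (zero_ext {\<delta>-\<eta>..\<delta>+\<eta>} \<omega>\<^sub>d) h" for h
      using assms(17) by (intro weight_nonneg) (simp add: zero_ext_def)
    show "(\<Sum>h = \<lfloor>(\<delta> - \<eta>) / dx\<rfloor> .. \<lfloor>(\<delta> + \<eta>) / dx\<rfloor> - 1.
        weight dx (zero_ext {\<delta>-\<eta>..\<delta>+\<eta>} \<omega>\<^sub>d) h) \<le> 1"
      using sum_weight_zero_ext_le[OF \<open>dx > 0\<close> _ \<omega>d_cont assms(17)] assms(20) by simp
  qed (use that in simp)

  have v_deriv: "DERIV v x :> deriv v x" for x
    using assms(6) unfolding C1_on_def differentiable_on_def
    by (auto simp: DERIV_deriv_iff_real_differentiable)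
  have v_cont: "continuous_on {0..1} v" and dv_cont: "continuous_on {0..1} (deriv v)"
    using assms(6,7) by (auto dest!: C1_on_continuous_on elim: continuous_on_subset)
  obtain V where V: "Linf_norm {0..1} v = ereal V" "0 \<le> V"
    "AE x in lebesgue. x \<in> {0..1} \<longrightarrow> \<bar>v x\<bar> \<le> V"
    using Linf_Icc_bound[OF _ continuous_on_Icc_Linf[OF v_cont]] by auto
  obtain D where D: "Linf_norm {0..1} (deriv v) = ereal D" "0 \<le> D"
    "AE x in lebesgue. x \<in> {0..1} \<longrightarrow> \<bar>deriv v x\<bar> \<le> D"
    using Linf_Icc_bound[OF _ continuous_on_Icc_Linf[OF dv_cont]] by auto
  have v_bound: "0 \<le> v x \<and> v x \<le> V" if "x \<in> {0..1}" for x
    using continuous_on_Icc_AE_bound[OF _ v_cont V(3) that] assms(8)[of x] by auto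
  have v_slope: "v y \<le> v x \<and> v x - v y \<le> D * (y - x)" if xy: "0 \<le> x" "x \<le> y" "y \<le> 1" for x y
  proof (cases "x = y")
    case False
    with xy obtain z where z: "x < z" "z < y" "v y - v x = (y - x) * deriv v z"
      using MVT2[of x y v "deriv v"] v_deriv by auto
    have "- deriv v z \<le> D"
      using continuous_on_Icc_AE_bound[OF _ dv_cont D(3), of z] z xy by auto
    then have "(y - x) * (- deriv v z) \<le> (y - x) * D"
      using xy by (intro mult_left_mono) auto
    moreover have "(y - x) * deriv v z \<le> 0"
      using xy assms(9) by (intro mult_nonneg_nonpos) auto
    ultimately show ?thesis
      using z(3) by (simp add: algebra_simps)
  qed simp

  have Linf_T: "q \<in> Linf {0..T}" if "q \<in> Linf {0..}" for q
    using that by (rule Linf_mono) auto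
  obtain Q\<^sub>i where Qi: "Linf_norm {0..T} q_on = ereal Q\<^sub>i" "0 \<le> Q\<^sub>i"
    "AE t in lebesgue. t \<in> {0..T} \<longrightarrow> \<bar>q_on t\<bar> \<le> Q\<^sub>i"
    using Linf_Icc_bound[OF \<open>T > 0\<close> Linf_T[OF assms(2)]] by auto
  obtain Q\<^sub>o where Qo: "Linf_norm {0..T} q_off = ereal Q\<^sub>o" "0 \<le> Q\<^sub>o"
    "AE t in lebesgue. t \<in> {0..T} \<longrightarrow> \<bar>q_off t\<bar> \<le> Q\<^sub>o"
    using Linf_Icc_bound[OF \<open>T > 0\<close> Linf_T[OF assms(4)]] by auto
  have q_nonneg: "AE t in lebesgue. t \<in> {0..} \<longrightarrow> 0 \<le> q_on t"
    "AE t in lebesgue. t \<in> {0..} \<longrightarrow> 0 \<le> q_off t"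
    using assms(3,5) by (auto simp: AE_restrict_space_iff)

  have cfl: "dt * (weight dx \<omega> 0 * D + V) \<le> dx" "dt * (Q\<^sub>i + Q\<^sub>o) \<le> of_int l * dx"
    using assms(29) V(2) D(2) Qi(2) Qo(2) \<gamma>_nonneg[of 0] \<open>0 < N\<close> \<open>dx > 0\<close> \<open>l > 0\<close>
    unfolding V(1) D(1) Qi(1) Qo(1)
    by (auto intro!: step_restriction_real)

  let ?r = "rho dx dt N v \<omega> \<eta> \<delta> \<omega>\<^sub>d k_on k_off l q_on q_off \<rho>0"
  have range: "?r n j \<in> {0..1}" if "n \<le> NT" for n j
    using that
  proof (induction n arbitrary: j)
    case 0
    then show ?case
      using cell_avg_in_unit_interval[OF \<open>dx > 0\<close> assms(28)] by simp
  next
    case (Suc n)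
    define r where "r = half_step dx dt N v \<omega> (?r n)"
    have r: "r i \<in> {0..1}" for i
      unfolding r_def
      by (rule half_step_in_unit_interval[OF \<open>dx > 0\<close> \<open>dt > 0\<close> \<open>0 < N\<close> \<gamma>_nonneg \<gamma>_anti \<gamma>_sum
            v_bound v_slope D(2) cfl(1)])
        (use Suc in auto)
    \<comment> \<open>the bounds on the fluxes hold on \<open>[0,T]\<close> only, so the averaging interval must not leave it\<close>
    have "time dt (n + 1) \<le> real NT * dt"
      unfolding time_def using Suc.prems \<open>dt > 0\<close> by (intro mult_right_mono) auto
    then have tT: "time dt (n + 1) \<le> T"
      using \<open>real NT * dt \<le> T\<close> by linarith
    note q_on_avg = time_avg_bounds[OF \<open>dt > 0\<close> Qi(2) tT q_nonneg(1) Qi(3)]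
      and q_off_avg = time_avg_bounds[OF \<open>dt > 0\<close> Qo(2) tT q_nonneg(2) Qo(3)]
      and ind = ramp_ind_bounds[OF \<open>dx > 0\<close> \<open>l > 0\<close>]
    define a where "a = dt * (ramp_ind dx k_on l j * time_avg dt q_on n)"
    define b where "b = dt * (ramp_ind dx k_off l j * time_avg dt q_off n)"
    have L: "0 < of_int l * dx"
      using \<open>dx > 0\<close> \<open>l > 0\<close> by simp
    have "0 \<le> a" "0 \<le> b"
      using \<open>dt > 0\<close> q_on_avg(1) q_off_avg(1) ind(1) by (simp_all add: a_def b_def)
    moreover have "a + b \<le> 1"
    proof -
      have "a + b \<le> dt * (1 / (of_int l * dx) * Q\<^sub>i) + dt * (1 / (of_int l * dx) * Q\<^sub>o)"
        unfolding a_def b_def using \<open>dt > 0\<close> q_on_avg q_off_avg ind L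
        by (intro add_mono mult_left_mono mult_mono) auto
      also have "\<dots> = dt * (Q\<^sub>i + Q\<^sub>o) / (of_int l * dx)"
        by (simp add: algebra_simps add_divide_distrib)
      also have "\<dots> \<le> 1"
        using cfl(2) L by simp
      finally show ?thesis .
    qed
    ultimately have "0 \<le> a" "a \<le> 1" "0 \<le> b" "b \<le> 1"
      by linarith+
    then have "r j + a * (1 - r j) * (1 - R_on dx \<eta> \<delta> \<omega>\<^sub>d r j) - b * r j \<in> {0..1}"
      using r R_on_range[of r, OF r] by (intro source_update_in_unit_interval)
    then show ?case
      by (simp add: Let_def r_def S_on_def S_off_def a_def b_def mult.assoc)
  qed
  have "pw_const dx dt T NT ?r t x \<in> {0..1}" if "t \<in> {0..T}" for t x
    using \<open>dx > 0\<close> \<open>dt > 0\<close> \<open>T < (real NT + 1) * dt\<close> that range by (rule pw_const_range)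
  then show ?thesis by simp
qed

end
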